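(* Let $1 < p < \infty$ and $f \in JN_p(\mathbb{R}^n)$. Then $f \in L^{p,\infty}(\mathbb{R}^n)/\mathbb{R}$, and there is a constant $b \in \mathbb{R}$ such that $$\| f - b \|_{L^{p,\infty}(\mathbb{R}^n)} \leq c \, \| f \|_{JN_p(\mathbb{R}^n)},$$ where $c = c(n,p)$ depends only on $n$ and $p$.
   Context: All cubes in $\mathbb{R}^n$ have edges parallel to the coordinate axes. For an integrable function $h$ on a cube $Q$ write $h_Q := \frac{1}{|Q|}\int_Q h$. A function $f$ belongs to $JN_p(\mathbb{R}^n)$ if $f \in L^1_{loc}(\mathbb{R}^n)$ and there is a constant $K<\infty$ such that $\sum_{i=1}^\infty |Q_i| \left( \frac{1}{|Q_i|}\int_{Q_i} |f - f_{Q_i}| \right)^p \leq K^p$ for all countable collections of pairwise disjoint (bounded) cubes $(Q_i)_{i=1}^\infty$ in $\mathbb{R}^n$; the smallest such $K$ is denoted $\|f\|_{JN_p(\mathbb{R}^n)}$. The weak $L^p$ quasinorm is $\|h\|_{L^{p,\infty}(\mathbb{R}^n)} := \sup_{t>0} t\, |\{x \in \mathbb{R}^n : |h(x)|>t\}|^{1/p}$, and $L^{p,\infty}(\mathbb{R}^n)$ is the set of measurable functions for which it is finite. For $p>1$, $L^{p,\infty}(\mathbb{R}^n)/\mathbb{R} := \{ f \in L^1_{loc}(\mathbb{R}^n) : \exists\, c \in \mathbb{R} \text{ such that } f - c \in L^{p,\infty}(\mathbb{R}^n) \}$. *)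

theory Defs
  imports "HOL-Analysis.Analysis"
begin

(* Bounded nondegenerate cubes with edges parallel to the axes. Each factor I i is one of the
   four intervals with endpoints a $ i and a $ i + l, so open, closed and half-open cubes are
   all included. *)
definition is_cube :: "(real ^ 'n) set \<Rightarrow> bool" where
  "is_cube Q \<longleftrightarrow> (\<exists>(a :: real ^ 'n) l I. 0 < l \<and>
      (\<forall>i. {a $ i <..< a $ i + l} \<subseteq> I i \<and> I i \<subseteq> {a $ i .. a $ i + l}) \<and>
      Q = {x. \<forall>i. x $ i \<in> I i})"

definition locally_integrable :: "(real ^ 'n \<Rightarrow> real) \<Rightarrow> bool" where
  "locally_integrable f \<longleftrightarrow> (\<forall>S. compact S \<longrightarrow> set_integrable lebesgue S f)"

definition average :: "(real ^ 'n) set \<Rightarrow> (real ^ 'n \<Rightarrow> real) \<Rightarrow> real" where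
  "average Q h = (LINT x:Q|lebesgue. h x) / measure lebesgue Q"

definition mean_oscillation :: "(real ^ 'n) set \<Rightarrow> (real ^ 'n \<Rightarrow> real) \<Rightarrow> real" where
  "mean_oscillation Q f = average Q (\<lambda>x. \<bar>f x - average Q f\<bar>)"

(* The sum is taken in ennreal, so that a divergent sum is infinity rather than 0. Distinct
   disjoint cubes are distinct as sets, so a countable collection may be given as a set. *)
definition JN_bound :: "real \<Rightarrow> (real ^ 'n \<Rightarrow> real) \<Rightarrow> real \<Rightarrow> bool" where
  "JN_bound p f K \<longleftrightarrow> 0 \<le> K \<and>
     (\<forall>C. countable C \<and> (\<forall>Q\<in>C. is_cube Q) \<and> disjoint C \<longrightarrow>
        (\<Sum>\<^sub>\<infinity>Q\<in>C. ennreal (measure lebesgue Q * mean_oscillation Q f powr p)) \<le> ennreal (K powr p))"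

definition JN :: "real \<Rightarrow> (real ^ 'n \<Rightarrow> real) set" where
  "JN p = {f. locally_integrable f \<and> (\<exists>K. JN_bound p f K)}"

definition JN_norm :: "real \<Rightarrow> (real ^ 'n \<Rightarrow> real) \<Rightarrow> real" where
  "JN_norm p f = Inf {K. JN_bound p f K}"

definition ennreal_powr :: "ennreal \<Rightarrow> real \<Rightarrow> ennreal" where
  "ennreal_powr a r = (if a = \<infinity> then \<infinity> else ennreal (enn2real a powr r))"

definition weak_Lp_norm :: "real \<Rightarrow> (real ^ 'n \<Rightarrow> real) \<Rightarrow> ennreal" where
  "weak_Lp_norm p h =
     (SUP t\<in>{0<..}. ennreal t * ennreal_powr (emeasure lebesgue {x. \<bar>h x\<bar> > t}) (1 / p))"

definition weak_Lp :: "real \<Rightarrow> (real ^ 'n \<Rightarrow> real) set" where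
  "weak_Lp p = {h \<in> borel_measurable lebesgue. weak_Lp_norm p h < \<infinity>}"

definition weak_Lp_mod_const :: "real \<Rightarrow> (real ^ 'n \<Rightarrow> real) set" where
  "weak_Lp_mod_const p = {f. locally_integrable f \<and> (\<exists>c. (\<lambda>x. f x - c) \<in> weak_Lp p)}"

end

theory Submission
  imports Defs
begin

text \<open>
  Every function of class JN is controlled, on each cube \<open>Q\<close>, by a weak-type form of the
  John--Nirenberg inequality: the part of \<open>Q\<close> on which \<open>f\<close> differs from its average over \<open>Q\<close> by more
  than \<open>t\<close> has measure at most \<open>C (K / t) ^ p\<close>, with \<open>C\<close> depending only on the dimension \<open>n\<close> and on \<open>p\<close>.
  Since \<open>C\<close> does not see the size of \<open>Q\<close>, the inequality survives when the cubes exhaust the space.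

  On a fixed cube \<open>Q\<close> with average \<open>c\<close>, let \<open>E t\<close> be the union of the dyadic subcubes over which
  \<open>\<bar>f - c\<bar>\<close> has average above \<open>t\<close>. The maximal subcubes \<open>R\<close> of this kind partition \<open>E t\<close>, and because
  the parent of \<open>R\<close> fails to qualify, the average of \<open>f\<close> over \<open>R\<close> is within \<open>2 ^ n t\<close> of \<open>c\<close>. A point of
  \<open>R\<close> that is still in \<open>E (L t)\<close>, where \<open>L = 2 ^ n + 1\<close>, therefore lies in a dyadic subcube of \<open>R\<close>
  over which \<open>f\<close> deviates from its average on \<open>R\<close> by at least \<open>t\<close> in the mean, and the dyadic maximal
  inequality gives \<open>t \<bar>E (L t) \<inter> R\<bar> \<le> \<bar>R\<bar> osc R\<close>, where \<open>osc R\<close> is the mean oscillation of \<open>f\<close> over \<open>R\<close>.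
  To sum over \<open>R\<close>, bound \<open>osc R\<close> by \<open>s + s powr (1 - p) * osc R powr p\<close>; the first term
  contributes \<open>s \<bar>E t\<bar>\<close> and the second one is summed by the JN condition. This is
  \<open>good_lambda_inequality\<close>. With \<open>s\<close> a small multiple of \<open>t\<close> it reads
  \<open>A (L t) \<le> A t / 2 + const\<close> for \<open>A t = t powr p \<bar>E t\<bar>\<close>, and iterating it
  (\<open>iterate_good_lambda\<close>) bounds \<open>A\<close>. A dyadic form of the Lebesgue differentiation theorem
  (\<open>null_set_low_dyadic_averages\<close>) shows that \<open>E t\<close> contains almost all points of \<open>Q\<close> at which
  \<open>\<bar>f - c\<bar>\<close> exceeds \<open>t\<close>.

  For the cubes of side \<open>2 ^ (m + 1)\<close> centred at the origin the JN condition makes the mean oscillation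
  decay geometrically in \<open>m\<close>, so the averages converge; their limit is the constant \<open>b\<close>. For a given
  \<open>t\<close> and all large \<open>m\<close> the average is within \<open>t / 2\<close> of \<open>b\<close>, so the local inequality at height
  \<open>t / 2\<close> bounds the part of the cube on which \<open>f\<close> differs from \<open>b\<close> by more than \<open>t\<close>, and \<open>m\<close> tends
  to infinity.
\<close>

section \<open>Dyadic cubes\<close>

text \<open>The cells of generation \<open>k\<close> in the subdivision of the half-open cube with lower corner \<open>a\<close> and side
\<open>l\<close>, continued periodically to the whole space. Describing a cell as the set of points with the same
integer parts as \<open>x\<close> makes the cells of one generation visibly a partition; their shape as products of
half-open intervals is recovered in \<open>dyadic_cube_intervals\<close>. The cell \<open>dyadic_cube a l 0 a\<close> is the
cube that is being subdivided.\<close>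

definition dyadic_cube :: "real ^ 'n \<Rightarrow> real \<Rightarrow> nat \<Rightarrow> real ^ 'n \<Rightarrow> (real ^ 'n) set" where
  "dyadic_cube a l k x =
     {y. \<forall>i. \<lfloor>2 ^ k * ((y $ i - a $ i) / l)\<rfloor> = \<lfloor>2 ^ k * ((x $ i - a $ i) / l)\<rfloor>}"

definition dyadic_cubes :: "real ^ 'n \<Rightarrow> real \<Rightarrow> (real ^ 'n) set set" where
  "dyadic_cubes a l = {dyadic_cube a l k x | k x. True}"

lemma dyadic_cube_self: "x \<in> dyadic_cube a l k x"
  by (simp add: dyadic_cube_def)

lemma dyadic_cube_eq: "y \<in> dyadic_cube a l k x \<Longrightarrow> dyadic_cube a l k y = dyadic_cube a l k x"
  by (simp add: dyadic_cube_def)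

lemma dyadic_cube_in_dyadic_cubes: "dyadic_cube a l k x \<in> dyadic_cubes a l"
  by (auto simp: dyadic_cubes_def)

lemma dyadic_cubes_memE:
  assumes "R \<in> dyadic_cubes a l" "x \<in> R"
  obtains k where "R = dyadic_cube a l k x"
  using assms dyadic_cube_eq unfolding dyadic_cubes_def by blast

lemma dyadic_cube_Suc_subset: "dyadic_cube a l (Suc k) x \<subseteq> dyadic_cube a l k x"
proof -
  have *: "\<lfloor>2 ^ k * u\<rfloor> = \<lfloor>2 ^ Suc k * u\<rfloor> div 2" for u :: real
    using floor_divide_real_eq_div[of 2 "2 ^ Suc k * u"] by simp
  show ?thesis
    unfolding dyadic_cube_def * by auto
qed

lemma dyadic_cube_mono: "j \<le> k \<Longrightarrow> dyadic_cube a l k x \<subseteq> dyadic_cube a l j x"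
  by (induction rule: dec_induct) (use dyadic_cube_Suc_subset in blast)+

lemma dyadic_cubes_nested:
  assumes "R \<in> dyadic_cubes a l" "S \<in> dyadic_cubes a l" "x \<in> R" "x \<in> S"
  shows "R \<subseteq> S \<or> S \<subseteq> R"
  by (metis assms dyadic_cubes_memE dyadic_cube_mono nat_le_linear)

lemma countable_dyadic_cubes: "countable (dyadic_cubes (a :: real ^ 'n) l)"
proof -
  have "dyadic_cubes a l \<subseteq> range (\<lambda>(k, v :: int ^ 'n).
      {y. \<forall>i. \<lfloor>2 ^ k * ((y $ i - a $ i) / l)\<rfloor> = v $ i})"
  proof
    fix R assume "R \<in> dyadic_cubes a l"
    then obtain k x where "R = dyadic_cube a l k x"
      unfolding dyadic_cubes_def by blast
    then show "R \<in> range (\<lambda>(k, v :: int ^ 'n).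
        {y. \<forall>i. \<lfloor>2 ^ k * ((y $ i - a $ i) / l)\<rfloor> = v $ i})"
      by (intro image_eqI[of _ _ "(k, \<chi> i. \<lfloor>2 ^ k * ((x $ i - a $ i) / l)\<rfloor>)"])
        (auto simp: dyadic_cube_def)
  qed
  then show ?thesis
    by (rule countable_subset) simp
qed

text \<open>Passing to the maximal members of a family makes it disjoint without changing its union. Generations are
natural numbers, so a point of the union lies in a member of least generation, and that member is
maximal because any larger one would have an even smaller generation.\<close>

lemma dyadic_maximal_subfamily:
  assumes "\<A> \<subseteq> dyadic_cubes a l"
  obtains \<B> where "\<B> \<subseteq> \<A>" "disjoint \<B>" "\<Union>\<B> = \<Union>\<A>" "countable \<B>"
    "\<And>Q R. Q \<in> \<B> \<Longrightarrow> R \<in> \<A> \<Longrightarrow> Q \<subseteq> R \<Longrightarrow> R = Q"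
proof
  define \<B> where "\<B> = {Q \<in> \<A>. \<forall>R\<in>\<A>. Q \<subseteq> R \<longrightarrow> R = Q}"
  show sub: "\<B> \<subseteq> \<A>"
    by (auto simp: \<B>_def)
  show "R = Q" if "Q \<in> \<B>" "R \<in> \<A>" "Q \<subseteq> R" for Q R
    using that by (auto simp: \<B>_def)
  show "countable \<B>"
    using sub assms countable_dyadic_cubes countable_subset by metis
  show "disjoint \<B>"
  proof (rule disjointI)
    fix Q R assume QR: "Q \<in> \<B>" "R \<in> \<B>" "Q \<noteq> R"
    have "Q \<subseteq> R \<or> R \<subseteq> Q" if "x \<in> Q \<inter> R" for x
      using dyadic_cubes_nested[of Q a l R x] that QR sub assms by blast
    then show "Q \<inter> R = {}"
      using QR unfolding \<B>_def by blast
  qed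
  have "\<exists>Q\<in>\<B>. x \<in> Q" if xS: "x \<in> S" "S \<in> \<A>" for x S
  proof -
    define k where "k = (LEAST k. dyadic_cube a l k x \<in> \<A>)"
    have "S \<in> dyadic_cubes a l"
      using xS assms by blast
    then obtain m where "S = dyadic_cube a l m x"
      using xS(1) by (rule dyadic_cubes_memE)
    then have k: "dyadic_cube a l k x \<in> \<A>"
      unfolding k_def using xS(2) by (auto intro: LeastI)
    have "R = dyadic_cube a l k x" if R: "R \<in> \<A>" "dyadic_cube a l k x \<subseteq> R" for R
    proof -
      have "R \<in> dyadic_cubes a l" "x \<in> R"
        using R(1) assms subsetD[OF R(2) dyadic_cube_self] by blast+
      then obtain j where j: "R = dyadic_cube a l j x"
        by (rule dyadic_cubes_memE)
      then have "k \<le> j"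
        unfolding k_def using R(1) by (simp add: Least_le)
      with j R(2) show ?thesis
        using dyadic_cube_mono by blast
    qed
    then show ?thesis
      using k dyadic_cube_self unfolding \<B>_def by blast
  qed
  then show "\<Union>\<B> = \<Union>\<A>"
    using sub by blast
qed

context
  fixes l :: real
  assumes l: "0 < l"
begin

lemma dyadic_cube_intervals:
  "dyadic_cube a l k x = {y. \<forall>i. y $ i \<in>
     {a $ i + l / 2 ^ k * \<lfloor>2 ^ k * ((x $ i - a $ i) / l)\<rfloor> ..<
      a $ i + l / 2 ^ k * \<lfloor>2 ^ k * ((x $ i - a $ i) / l)\<rfloor> + l / 2 ^ k}}"
proof -
  have "\<lfloor>2 ^ k * ((u - b) / l)\<rfloor> = z \<longleftrightarrow> u \<in> {b + l / 2 ^ k * z ..< b + l / 2 ^ k * z + l / 2 ^ k}"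
    for u b and z :: int
    unfolding floor_eq_iff using l by (auto simp: field_simps)
  then show ?thesis
    unfolding dyadic_cube_def by simp
qed

lemma dyadic_cube_base: "dyadic_cube a l 0 a = {y. \<forall>i. y $ i \<in> {a $ i ..< a $ i + l}}"
  using dyadic_cube_intervals[of a 0 a] by simp

lemma dyadic_cube_sandwich:
  obtains c where "box c (\<chi> i. c $ i + l / 2 ^ k) \<subseteq> dyadic_cube a l k x"
    "dyadic_cube a l k x \<subseteq> cbox c (\<chi> i. c $ i + l / 2 ^ k)"
    "is_cube (dyadic_cube a l k x)"
proof
  define c where "c = (\<chi> i. a $ i + l / 2 ^ k * \<lfloor>2 ^ k * ((x $ i - a $ i) / l)\<rfloor>)"
  have eq: "dyadic_cube a l k x = {y. \<forall>i. y $ i \<in> {c $ i ..< c $ i + l / 2 ^ k}}"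
    unfolding dyadic_cube_intervals c_def by simp
  show "box c (\<chi> i. c $ i + l / 2 ^ k) \<subseteq> dyadic_cube a l k x"
    "dyadic_cube a l k x \<subseteq> cbox c (\<chi> i. c $ i + l / 2 ^ k)"
    unfolding eq by (auto simp: mem_box_cart less_imp_le)
  show "is_cube (dyadic_cube a l k x)"
    unfolding is_cube_def eq
    by (intro exI[of _ c] exI[of _ "l / 2 ^ k"] exI[of _ "\<lambda>i. {c $ i ..< c $ i + l / 2 ^ k}"])
      (use l in auto)
qed

lemma is_cube_dyadic_cube: "is_cube (dyadic_cube a l k x)"
  using dyadic_cube_sandwich by blast

text \<open>A cell lies between an open and a closed box with the same corners, which differ by a null set.\<close>

lemma dyadic_cube_lebesgue:
  fixes a x :: "real ^ 'n"
  shows lmeasurable_dyadic_cube: "dyadic_cube a l k x \<in> lmeasurable"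
    and measure_dyadic_cube: "measure lebesgue (dyadic_cube a l k x) = (l / 2 ^ k) ^ CARD('n)"
    and bounded_dyadic_cube: "bounded (dyadic_cube a l k x)"
proof -
  obtain c where c: "box c (\<chi> i. c $ i + l / 2 ^ k) \<subseteq> dyadic_cube a l k x"
      "dyadic_cube a l k x \<subseteq> cbox c (\<chi> i. c $ i + l / 2 ^ k)" (is "_ \<subseteq> ?C")
    using dyadic_cube_sandwich by metis
  have "negligible (?C - dyadic_cube a l k x)"
    using c(1) by (intro negligible_subset[OF negligible_frontier_interval]) blast
  moreover have "sym_diff ?C (dyadic_cube a l k x) = ?C - dyadic_cube a l k x"
    using c(2) by blast
  ultimately have neg: "negligible (sym_diff ?C (dyadic_cube a l k x))"
    by simp
  show "dyadic_cube a l k x \<in> lmeasurable"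
    using lmeasurable_negligible_symdiff[OF lmeasurable_cbox neg] .
  have "measure lebesgue (dyadic_cube a l k x) = measure lebesgue ?C"
    using measure_negligible_symdiff[OF lmeasurable_cbox neg] .
  also have "\<dots> = measure lborel ?C"
    by simp
  also have "\<dots> = (l / 2 ^ k) ^ CARD('n)"
    using l by (subst content_cbox_cart) (auto simp: interval_ne_empty_cart less_imp_le)
  finally show "measure lebesgue (dyadic_cube a l k x) = (l / 2 ^ k) ^ CARD('n)" .
  show "bounded (dyadic_cube a l k x)"
    using c(2) bounded_cbox bounded_subset by blast
qed

lemma measure_dyadic_cube_Suc:
  fixes a x :: "real ^ 'n"
  shows "measure lebesgue (dyadic_cube a l k x) =
    2 ^ CARD('n) * measure lebesgue (dyadic_cube a l (Suc k) x)"
  by (simp add: measure_dyadic_cube power_divide power_mult_distrib)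

lemma dyadic_cube_subset_open:
  fixes a x :: "real ^ 'n"
  assumes "open U" "x \<in> U"
  obtains k where "dyadic_cube a l k x \<subseteq> U"
proof -
  obtain e where e: "0 < e" "ball x e \<subseteq> U"
    using assms openE by blast
  define n where "n = real CARD('n)"
  have "0 < n" unfolding n_def by (simp add: card_gt_0_iff)
  obtain k where k: "n * l / e < 2 ^ k"
    using real_arch_pow[of 2 "n * l / e"] by (meson one_less_numeral_iff semiring_norm(76))
  have "y \<in> ball x e" if "y \<in> dyadic_cube a l k x" for y
  proof -
    have "\<bar>y $ i - x $ i\<bar> \<le> l / 2 ^ k" for i
    proof -
      have "u \<in> {c ..< c + d} \<Longrightarrow> v \<in> {c ..< c + d} \<Longrightarrow> \<bar>u - v\<bar> \<le> d" for u v c d :: real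
        by auto
      then show ?thesis
        using that dyadic_cube_self[of x a l k] unfolding dyadic_cube_intervals by blast
    qed
    then have "(\<Sum>i\<in>UNIV. \<bar>(y - x) $ i\<bar>) \<le> (\<Sum>i\<in>(UNIV :: 'n set). l / 2 ^ k)"
      by (intro sum_mono) simp
    then have "norm (y - x) \<le> n * (l / 2 ^ k)"
      using norm_le_l1_cart[of "y - x"] by (simp add: n_def)
    also have "\<dots> < e"
      using k e by (simp add: field_simps)
    finally show ?thesis
      by (simp add: dist_norm norm_minus_commute)
  qed
  then show ?thesis
    using that e by blast
qed

end

lemma dyadic_cubesD:
  fixes a :: "real ^ 'n"
  assumes "0 < l" "Q \<in> dyadic_cubes a l"
  shows "is_cube Q" "Q \<in> lmeasurable" "bounded Q" "0 < measure lebesgue Q"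
  using assms
  by (auto simp: dyadic_cubes_def is_cube_dyadic_cube lmeasurable_dyadic_cube bounded_dyadic_cube
      measure_dyadic_cube)

section \<open>Covering arguments and dyadic differentiation\<close>

lemma emeasure_Union_disjoint:
  assumes "countable \<B>" "disjoint \<B>" "\<B> \<subseteq> sets M"
  shows "emeasure M (\<Union>\<B>) = (\<integral>\<^sup>+Q. emeasure M Q \<partial>count_space \<B>)"
proof -
  have "emeasure M (\<Union>((\<lambda>Q. Q) ` \<B>)) = (\<integral>\<^sup>+Q. emeasure M Q \<partial>count_space \<B>)"
    by (rule emeasure_UN_countable) (use assms in \<open>auto simp: disjoint_family_on_def disjoint_def\<close>)
  then show ?thesis
    by simp
qed

text \<open>Brings an estimate known for finite families of cubes to countable ones.\<close>

lemma nn_integral_count_space_le: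
  fixes f :: "'a \<Rightarrow> ennreal"
  assumes "countable I" and le: "\<And>F. finite F \<Longrightarrow> F \<subseteq> I \<Longrightarrow> sum f F \<le> B"
  shows "(\<integral>\<^sup>+i. f i \<partial>count_space I) \<le> B"
proof (cases "finite I")
  case True
  then show ?thesis
    using le by (simp add: nn_integral_count_space_finite)
next
  case False
  let ?e = "from_nat_into I"
  have bij: "bij_betw ?e UNIV I"
    using False assms(1) bij_betw_from_nat_into by blast
  have "(\<integral>\<^sup>+i. f i \<partial>count_space I) = (\<Sum>n. f (?e n))"
    by (simp add: nn_integral_bij_count_space[OF bij, symmetric] nn_integral_count_space_nat)
  also have "\<dots> \<le> B"
  proof (rule suminf_le_const)
    fix n
    have "(\<Sum>i<n. f (?e i)) = sum f (?e ` {..<n})"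
      using bij by (subst sum.reindex) (auto simp: bij_betw_def inj_on_def)
    also have "\<dots> \<le> B"
      using bij by (intro le) (auto simp: bij_betw_def)
    finally show "(\<Sum>i<n. f (?e i)) \<le> B" .
  qed simp
  finally show ?thesis .
qed

text \<open>The union of an arbitrary family of dyadic cubes is the disjoint union of its maximal members, so a
comparison of two measures on the members passes to the union. With \<open>M\<close> Lebesgue measure and \<open>N\<close> the
integral of a function this is the weak-type maximal inequality; with the roles exchanged it is the
covering step in the differentiation theorem.\<close>

lemma dyadic_covering_inequality:
  fixes a :: "real ^ 'n"
  assumes l: "0 < l" and \<A>: "\<A> \<subseteq> dyadic_cubes a l"
    and M: "sets M = sets lebesgue" and N: "sets N = sets lebesgue"
    and le: "\<And>R. R \<in> \<A> \<Longrightarrow> c * emeasure M R \<le> d * emeasure N R"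
  shows "c * emeasure M (\<Union>\<A>) \<le> d * emeasure N (\<Union>\<A>)"
proof -
  obtain \<B> where \<B>: "\<B> \<subseteq> \<A>" "disjoint \<B>" "\<Union>\<B> = \<Union>\<A>" "countable \<B>"
    using dyadic_maximal_subfamily[OF \<A>] by metis
  have s: "\<B> \<subseteq> sets lebesgue"
    using \<B>(1) \<A> lmeasurable_dyadic_cube[OF l] unfolding dyadic_cubes_def by blast
  have "c * emeasure M (\<Union>\<B>) = (\<integral>\<^sup>+Q. c * emeasure M Q \<partial>count_space \<B>)"
    using \<B> s M by (subst emeasure_Union_disjoint) (auto simp: nn_integral_cmult)
  also have "\<dots> \<le> (\<integral>\<^sup>+Q. d * emeasure N Q \<partial>count_space \<B>)"
    using le \<B>(1) by (intro nn_integral_mono) auto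
  also have "\<dots> = d * emeasure N (\<Union>\<B>)"
    using \<B> s N by (subst emeasure_Union_disjoint) (auto simp: nn_integral_cmult)
  finally show ?thesis
    unfolding \<B>(3) .
qed

lemma sets_Union_dyadic_cubes:
  fixes a :: "real ^ 'n"
  assumes l: "0 < l" and \<A>: "\<A> \<subseteq> dyadic_cubes a l"
  shows "\<Union>\<A> \<in> sets lebesgue"
proof (rule sets.countable_Union)
  show "countable \<A>"
    using \<A> countable_dyadic_cubes countable_subset by blast
  show "\<A> \<subseteq> sets lebesgue"
    using \<A> lmeasurable_dyadic_cube[OF l] unfolding dyadic_cubes_def by blast
qed

text \<open>The only consequence of Lebesgue's differentiation theorem that the argument needs: a function cannot be
larger than \<open>t\<close> at the points of a set of positive measure if all its dyadic averages around these points
are at most \<open>t\<close>. Cover \<open>S\<close> by dyadic cubes inside an open set that is barely larger. The averages over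
these cubes are at most \<open>t\<close>, whence the integral of \<open>h\<close> over \<open>S\<close> is at most \<open>t\<close> times the measure of
\<open>S\<close>; as \<open>h > t\<close> on \<open>S\<close>, this forces \<open>S\<close> to be null.\<close>

lemma null_set_low_dyadic_averages:
  fixes a :: "real ^ 'n" and h :: "real ^ 'n \<Rightarrow> ennreal"
  assumes l: "0 < l" and h: "h \<in> borel_measurable lebesgue" and S: "S \<in> lmeasurable"
    and high: "\<And>x. x \<in> S \<Longrightarrow> ennreal t < h x"
    and low: "\<And>x k. x \<in> S \<Longrightarrow> emeasure (density lebesgue h) (dyadic_cube a l k x)
      \<le> ennreal t * emeasure lebesgue (dyadic_cube a l k x)"
  shows "S \<in> null_sets lebesgue"
proof -
  let ?N = "density lebesgue h"
  have Sm[measurable]: "S \<in> sets lebesgue" using S by auto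
  have fin: "emeasure lebesgue S < \<infinity>"
    using S by (simp add: fmeasurable_def)
  have "emeasure ?N S \<le> ennreal t * emeasure lebesgue S + ennreal e" if e: "0 < e" for e
  proof -
    \<comment> \<open>chosen so that an excess measure of \<open>d\<close> contributes at most \<open>e\<close>; the maximum also covers \<open>t \<le> 0\<close>\<close>
    define d where "d = e / max 1 t"
    have d: "0 < d" "ennreal t * ennreal d \<le> ennreal e"
      using e by (auto simp: d_def field_simps max_def simp flip: ennreal_mult')
    obtain U where U: "open U" "S \<subseteq> U" "U - S \<in> lmeasurable" "emeasure lebesgue (U - S) < ennreal d"
      using sets_lebesgue_outer_open[OF Sm d(1)] by metis
    define \<A> where "\<A> = {R. \<exists>x\<in>S. \<exists>k. R = dyadic_cube a l k x \<and> R \<subseteq> U}"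
    have \<A>: "\<A> \<subseteq> dyadic_cubes a l" "\<Union>\<A> \<subseteq> U"
      by (auto simp: \<A>_def dyadic_cubes_def)
    have S\<A>: "S \<subseteq> \<Union>\<A>"
    proof
      fix x assume x: "x \<in> S"
      with U obtain k where "dyadic_cube a l k x \<subseteq> U"
        using dyadic_cube_subset_open[OF l] by blast
      with x show "x \<in> \<Union>\<A>"
        unfolding \<A>_def using dyadic_cube_self by blast
    qed
    have [measurable]: "\<Union>\<A> \<in> sets lebesgue"
      using sets_Union_dyadic_cubes[OF l \<A>(1)] .
    have "emeasure ?N S \<le> emeasure ?N (\<Union>\<A>)"
      using S\<A> by (intro emeasure_mono) auto
    also have "\<dots> \<le> ennreal t * emeasure lebesgue (\<Union>\<A>)"
      using dyadic_covering_inequality[OF l \<A>(1), of ?N lebesgue 1 "ennreal t"] low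
      by (auto simp: \<A>_def)
    also have "\<dots> \<le> ennreal t * (emeasure lebesgue S + emeasure lebesgue (U - S))"
    proof (intro mult_left_mono)
      have "emeasure lebesgue (\<Union>\<A>) \<le> emeasure lebesgue (S \<union> (U - S))"
        using \<A>(2) U(3) by (intro emeasure_mono sets.Un) auto
      also have "\<dots> \<le> emeasure lebesgue S + emeasure lebesgue (U - S)"
        using U(3) by (intro emeasure_subadditive) auto
      finally show "emeasure lebesgue (\<Union>\<A>) \<le> emeasure lebesgue S + emeasure lebesgue (U - S)" .
    qed simp
    also have "\<dots> \<le> ennreal t * emeasure lebesgue S + ennreal t * ennreal d"
      using U(4) by (auto simp: distrib_left intro!: add_left_mono mult_left_mono)
    also have "\<dots> \<le> ennreal t * emeasure lebesgue S + ennreal e"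
      using d(2) by (rule add_left_mono)
    finally show ?thesis .
  qed
  then have le: "emeasure ?N S \<le> ennreal t * emeasure lebesgue S"
    by (rule ennreal_le_epsilon)
  have N: "emeasure ?N S = (\<integral>\<^sup>+x. h x * indicator S x \<partial>lebesgue)"
    using h Sm by (rule emeasure_density)
  have T: "ennreal t * emeasure lebesgue S = (\<integral>\<^sup>+x. ennreal t * indicator S x \<partial>lebesgue)"
    by (simp add: nn_integral_cmult_indicator)
  have "(\<integral>\<^sup>+x. ennreal t * indicator S x \<partial>lebesgue) \<noteq> \<infinity>"
    unfolding T[symmetric] using fin by (simp add: ennreal_mult_eq_top_iff)
  then have "(\<integral>\<^sup>+x. h x * indicator S x - ennreal t * indicator S x \<partial>lebesgue) =
      emeasure ?N S - ennreal t * emeasure lebesgue S"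
    unfolding N T using h by (intro nn_integral_diff) (auto simp: high less_imp_le split: split_indicator)
  also have "\<dots> = 0"
  proof (rule diff_eq_0_ennreal[OF _ le])
    have "ennreal t * emeasure lebesgue S < top"
      using fin by (simp only: ennreal_mult_less_top ennreal_less_top infinity_ennreal_def) simp
    with le show "emeasure ?N S < top"
      by (rule order.strict_trans1)
  qed
  finally have "AE x in lebesgue. h x * indicator S x - ennreal t * indicator S x = 0"
    using h by (subst (asm) nn_integral_0_iff_AE) auto
  then have "AE x in lebesgue. x \<notin> S"
  proof eventually_elim
    case (elim x)
    then have "h x * indicator S x \<le> ennreal t * indicator S x"
      by (rule ennreal_minus_eq_0)
    then show ?case
      using high[of x] by (cases "x \<in> S") auto
  qed
  then show ?thesis
    by (simp add: AE_iff_null_sets)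
qed

section \<open>Averages and mean oscillation\<close>

lemma borel_measurable_locally_integrable:
  fixes f :: "real ^ 'n \<Rightarrow> real"
  assumes "locally_integrable f"
  shows "f \<in> borel_measurable lebesgue"
proof (rule borel_measurable_LIMSEQ_real)
  fix m :: nat
  show "(\<lambda>x. indicator (cball 0 (real m)) x * f x) \<in> borel_measurable lebesgue"
    using assms compact_cball[of 0 "real m"]
    by (auto simp: locally_integrable_def set_integrable_def dest!: spec[of _ "cball 0 (real m)"] borel_measurable_integrable)
next
  fix x :: "real ^ 'n"
  obtain m where "norm x \<le> real m"
    using real_arch_simple by blast
  then have "\<forall>k\<ge>m. indicator (cball 0 (real k)) x * f x = f x"
    by auto
  then show "(\<lambda>m. indicator (cball 0 (real m)) x * f x) \<longlonglongrightarrow> f x"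
    by (intro tendsto_eventually) (auto simp: eventually_sequentially)
qed

lemma set_integrable_locally_integrable:
  assumes "locally_integrable f" "bounded Q" "Q \<in> sets lebesgue"
  shows "set_integrable lebesgue Q f"
proof -
  have "set_integrable lebesgue (closure Q) f"
    using assms by (simp add: locally_integrable_def compact_closure)
  then show ?thesis
    using assms(3) closure_subset by (rule set_integrable_subset)
qed

text \<open>The integral of \<open>\<bar>f - c\<bar>\<close> as a set function: in this form, the covering inequality for measures
applies to it directly.\<close>

definition deviation_measure :: "(real ^ 'n \<Rightarrow> real) \<Rightarrow> real \<Rightarrow> (real ^ 'n) measure" where
  "deviation_measure f c = density lebesgue (\<lambda>x. ennreal \<bar>f x - c\<bar>)"

lemma sets_deviation_measure [simp]: "sets (deviation_measure f c) = sets lebesgue"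
  by (simp add: deviation_measure_def)

lemma emeasure_deviation_measure:
  assumes "f \<in> borel_measurable lebesgue" "Q \<in> sets lebesgue"
  shows "emeasure (deviation_measure f c) Q = (\<integral>\<^sup>+x. ennreal (indicator Q x * \<bar>f x - c\<bar>) \<partial>lebesgue)"
  unfolding deviation_measure_def using assms
  by (subst emeasure_density) (auto intro!: nn_integral_cong split: split_indicator)

lemma emeasure_deviation_measure_triangle:
  assumes f[measurable]: "f \<in> borel_measurable lebesgue" and Q[measurable]: "Q \<in> sets lebesgue"
  shows "emeasure (deviation_measure f c) Q \<le>
    emeasure (deviation_measure f d) Q + ennreal \<bar>d - c\<bar> * emeasure lebesgue Q"
proof -
  have "emeasure (deviation_measure f c) Q \<le>
      (\<integral>\<^sup>+x. ennreal (indicator Q x * \<bar>f x - d\<bar>) + ennreal \<bar>d - c\<bar> * indicator Q x \<partial>lebesgue)"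
    unfolding emeasure_deviation_measure[OF f Q]
    by (intro nn_integral_mono)
      (auto simp flip: ennreal_plus split: split_indicator)
  also have "\<dots> = emeasure (deviation_measure f d) Q + ennreal \<bar>d - c\<bar> * emeasure lebesgue Q"
    unfolding emeasure_deviation_measure[OF f Q]
    by (subst nn_integral_add) (auto simp: nn_integral_cmult_indicator)
  finally show ?thesis .
qed

lemma emeasure_deviation_measure_eq:
  assumes f: "locally_integrable f" and Q: "bounded Q" "Q \<in> lmeasurable"
  shows "emeasure (deviation_measure f c) Q = ennreal (LINT x:Q|lebesgue. \<bar>f x - c\<bar>)"
    and "set_integrable lebesgue Q (\<lambda>x. \<bar>f x - c\<bar>)"
    and "set_integrable lebesgue Q (\<lambda>x. f x - c)"
proof -
  have [measurable]: "f \<in> borel_measurable lebesgue"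
    using f by (rule borel_measurable_locally_integrable)
  have Qs: "Q \<in> sets lebesgue"
    using Q by auto
  have "set_integrable lebesgue Q (\<lambda>x. c)"
    using Q(2) by (simp add: set_integrable_def lmeasurable_iff_integrable)
  then show *: "set_integrable lebesgue Q (\<lambda>x. f x - c)"
    using set_integrable_locally_integrable[OF f Q(1) Qs] by simp
  then show **: "set_integrable lebesgue Q (\<lambda>x. \<bar>f x - c\<bar>)"
    by (rule set_integrable_abs)
  show "emeasure (deviation_measure f c) Q = ennreal (LINT x:Q|lebesgue. \<bar>f x - c\<bar>)"
    unfolding emeasure_deviation_measure[OF \<open>f \<in> borel_measurable lebesgue\<close> Qs] set_lebesgue_integral_def
    using ** unfolding set_integrable_def
    by (subst nn_integral_eq_integral) (auto simp: mult.commute)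
qed

lemma emeasure_deviation_measure_average:
  assumes f: "locally_integrable f" and Q: "bounded Q" "Q \<in> lmeasurable" "0 < measure lebesgue Q"
  shows "emeasure (deviation_measure f (average Q f)) Q =
    ennreal (measure lebesgue Q * mean_oscillation Q f)"
  unfolding emeasure_deviation_measure_eq(1)[OF f Q(1,2)] mean_oscillation_def
  using Q(3) by (simp add: average_def[of Q "\<lambda>x. \<bar>f x - average Q f\<bar>"])

lemma average_minus_const_le:
  assumes f: "locally_integrable f" and Q: "bounded Q" "Q \<in> lmeasurable" "0 < measure lebesgue Q"
  shows "\<bar>average Q f - c\<bar> * measure lebesgue Q \<le> (LINT x:Q|lebesgue. \<bar>f x - c\<bar>)"
proof -
  have Qs: "Q \<in> sets lebesgue"
    using Q by auto
  have c: "set_integrable lebesgue Q (\<lambda>x. c)" "(LINT x:Q|lebesgue. c) = c * measure lebesgue Q"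
    using Q(2) by (auto simp: set_integrable_def set_lebesgue_integral_def lmeasurable_iff_integrable)
  have "average Q f * measure lebesgue Q = (LINT x:Q|lebesgue. f x)"
    using Q(3) by (simp add: average_def)
  then have "(average Q f - c) * measure lebesgue Q = (LINT x:Q|lebesgue. f x - c)"
    using set_integral_diff(2)[OF set_integrable_locally_integrable[OF f Q(1) Qs] c(1)] c(2)
    by (simp add: left_diff_distrib)
  then have "\<bar>average Q f - c\<bar> * measure lebesgue Q = \<bar>LINT x:Q|lebesgue. f x - c\<bar>"
    using Q(3) by (metis abs_mult abs_of_pos)
  also have "\<dots> \<le> (LINT x:Q|lebesgue. \<bar>f x - c\<bar>)"
    using set_integral_norm_bound[OF emeasure_deviation_measure_eq(3)[OF f Q(1,2)]] by simp
  finally show ?thesis .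
qed

lemma mean_oscillation_nonneg: "0 \<le> mean_oscillation Q f"
  unfolding mean_oscillation_def average_def[of Q "\<lambda>x. \<bar>f x - average Q f\<bar>"] set_lebesgue_integral_def
  by simp

text \<open>Both averages are compared through the integral of \<open>\<bar>f - average R f\<bar>\<close> over \<open>Q\<close>, which can only grow when
\<open>Q\<close> is replaced by \<open>R\<close>.\<close>

lemma average_diff_le:
  fixes Q R :: "(real ^ 'n) set"
  assumes f: "locally_integrable f" and QR: "Q \<subseteq> R"
    and Q: "bounded Q" "Q \<in> lmeasurable" "0 < measure lebesgue Q"
    and R: "bounded R" "R \<in> lmeasurable"
  shows "\<bar>average Q f - average R f\<bar> \<le> measure lebesgue R / measure lebesgue Q * mean_oscillation R f"
proof -
  have R0: "0 < measure lebesgue R"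
    using Q(3) measure_mono_fmeasurable[OF QR _ R(2)] Q(2) by auto
  let ?c = "average R f"
  have "ennreal (LINT x:Q|lebesgue. \<bar>f x - ?c\<bar>) = emeasure (deviation_measure f ?c) Q"
    using emeasure_deviation_measure_eq(1)[OF f Q(1,2)] by simp
  also have "\<dots> \<le> emeasure (deviation_measure f ?c) R"
    using R(2) by (intro emeasure_mono[OF QR]) auto
  also have "\<dots> = ennreal (measure lebesgue R * mean_oscillation R f)"
    using emeasure_deviation_measure_average[OF f R R0] .
  finally have "(LINT x:Q|lebesgue. \<bar>f x - ?c\<bar>) \<le> measure lebesgue R * mean_oscillation R f"
    using R0 mean_oscillation_nonneg[of R f] by (simp add: ennreal_le_iff)
  with average_minus_const_le[OF f Q, of ?c] show ?thesis
    using Q(3) by (simp add: field_simps)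
qed

lemma JN_bound_mono:
  assumes "JN_bound p f K" "K \<le> M" "0 \<le> p"
  shows "JN_bound p f M"
proof -
  have K: "0 \<le> K"
    using assms(1) by (simp add: JN_bound_def)
  have "ennreal (K powr p) \<le> ennreal (M powr p)"
    using K assms by (intro ennreal_leI powr_mono2)
  then show ?thesis
    using assms(1) order_trans[OF K assms(2)] unfolding JN_bound_def by (meson order_trans)
qed

lemma JN_bound_count_space:
  assumes JN: "JN_bound p f K" and \<B>: "countable \<B>" "disjoint \<B>" "\<And>Q. Q \<in> \<B> \<Longrightarrow> is_cube Q"
  shows "(\<integral>\<^sup>+Q. ennreal (measure lebesgue Q * mean_oscillation Q f powr p) \<partial>count_space \<B>)
    \<le> ennreal (K powr p)"
proof (rule nn_integral_count_space_le[OF \<B>(1)])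
  fix F assume F: "finite F" "F \<subseteq> \<B>"
  then have "countable F \<and> (\<forall>Q\<in>F. is_cube Q) \<and> disjoint F"
    using \<B>(2,3) by (auto simp: countable_finite intro: pairwise_subset)
  then have "(\<Sum>\<^sub>\<infinity>Q\<in>F. ennreal (measure lebesgue Q * mean_oscillation Q f powr p)) \<le> ennreal (K powr p)"
    using JN unfolding JN_bound_def by blast
  then show "(\<Sum>Q\<in>F. ennreal (measure lebesgue Q * mean_oscillation Q f powr p)) \<le> ennreal (K powr p)"
    using F by simp
qed

lemma JN_bound_cube:
  assumes "JN_bound p f K" "is_cube Q"
  shows "measure lebesgue Q * mean_oscillation Q f powr p \<le> K powr p"
  using JN_bound_count_space[OF assms(1), of "{Q}"] assms(2)
  by (simp add: nn_integral_count_space_finite)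

text \<open>The JN condition for the single cube \<open>Q\<close>. It shows that the oscillation vanishes on large cubes.\<close>

lemma mean_oscillation_le:
  fixes Q :: "(real ^ 'n) set"
  assumes JN: "JN_bound p f K" and p: "0 < p" and Q: "is_cube Q" "0 < measure lebesgue Q"
  shows "mean_oscillation Q f \<le> K * measure lebesgue Q powr (- 1 / p)"
proof (rule ccontr)
  let ?v = "measure lebesgue Q"
  have K: "0 \<le> K"
    using JN by (simp add: JN_bound_def)
  assume "\<not> mean_oscillation Q f \<le> K * ?v powr (- 1 / p)"
  then have "(K * ?v powr (- 1 / p)) powr p < mean_oscillation Q f powr p"
    using K p by (intro powr_less_mono2) auto
  moreover have "(K * ?v powr (- 1 / p)) powr p = K powr p / ?v"
    unfolding powr_mult powr_powr using p Q(2) by (simp add: powr_minus divide_inverse)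
  ultimately have "K powr p < mean_oscillation Q f powr p * ?v"
    using Q(2) by (simp only: pos_divide_less_eq)
  then show False
    using JN_bound_cube[OF JN Q(1)] by (simp only: mult.commute)
qed

section \<open>The good-lambda inequality for the dyadic maximal function\<close>

text \<open>If \<open>u\<close> exceeds \<open>s\<close> then \<open>u = u powr (1 - p) * u powr p\<close>, and \<open>u powr (1 - p)\<close> is at most
\<open>s powr (1 - p)\<close>. Used with a free threshold \<open>s\<close>, this replaces Hoelder's inequality in the summation over
cubes and keeps the good-lambda inequality linear in the measures involved.\<close>

lemma le_split_powr:
  fixes u s p :: real
  assumes "0 \<le> u" "0 < s" "1 \<le> p"
  shows "u \<le> s + s powr (1 - p) * u powr p"
proof (cases "u \<le> s")
  case True
  then show ?thesis
    by (simp add: add_increasing2)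
next
  case False
  then have "s powr (p - 1) \<le> u powr (p - 1)"
    using assms by (intro powr_mono2) auto
  then have "u * s powr (p - 1) \<le> u powr p"
    using False assms by (simp add: powr_diff field_simps)
  then have "u \<le> s powr (1 - p) * u powr p"
    using assms by (simp add: powr_diff field_simps)
  then show ?thesis
    using assms by simp
qed

text \<open>The subcubes over which \<open>\<bar>f - c\<bar>\<close> has average above \<open>t\<close>. Their union is the set of points at which the
dyadic maximal function of \<open>f - c\<close>, localised to the base cube, exceeds \<open>t\<close>.\<close>

definition level_cubes :: "real ^ 'n \<Rightarrow> real \<Rightarrow> (real ^ 'n \<Rightarrow> real) \<Rightarrow> real \<Rightarrow> real \<Rightarrow> (real ^ 'n) set set" where
  "level_cubes a l f c t =
     {R \<in> dyadic_cubes a l. R \<subseteq> dyadic_cube a l 0 a \<and>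
        ennreal t * emeasure lebesgue R < emeasure (deviation_measure f c) R}"

lemma level_cubes_subset: "level_cubes a l f c t \<subseteq> dyadic_cubes a l"
  by (auto simp: level_cubes_def)

lemma level_cubes_antimono:
  assumes "s \<le> t"
  shows "level_cubes a l f c t \<subseteq> level_cubes a l f c s"
proof
  fix R assume R: "R \<in> level_cubes a l f c t"
  have "ennreal s * emeasure lebesgue R \<le> ennreal t * emeasure lebesgue R"
    using assms by (intro mult_right_mono ennreal_leI) simp_all
  also have "\<dots> < emeasure (deviation_measure f c) R"
    using R by (simp add: level_cubes_def)
  finally show "R \<in> level_cubes a l f c s"
    using R by (simp add: level_cubes_def)
qed

lemma lmeasurable_Union_level_cubes:
  assumes l: "0 < l"
  shows "\<Union>(level_cubes a l f c t) \<in> lmeasurable"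
proof (rule fmeasurableI2[OF lmeasurable_dyadic_cube[OF l, of a 0 a]])
  show "\<Union>(level_cubes a l f c t) \<subseteq> dyadic_cube a l 0 a"
    by (auto simp: level_cubes_def)
  show "\<Union>(level_cubes a l f c t) \<in> sets lebesgue"
    by (rule sets_Union_dyadic_cubes[OF l level_cubes_subset])
qed

text \<open>The Calderon--Zygmund stopping argument. By the hypothesis on the base cube, a maximal cube \<open>Q\<close> is not the
base cube, so it has a parent, and the parent has average at most \<open>t\<close>. Since the parent is only \<open>2 ^ n\<close>
times as large as \<open>Q\<close>, the average over \<open>Q\<close> is at most \<open>2 ^ n * t\<close>.\<close>

lemma level_cubes_maximal_average:
  fixes a :: "real ^ 'n"
  assumes l: "0 < l" and f: "locally_integrable f" and t: "0 \<le> t"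
    and base: "emeasure (deviation_measure f c) (dyadic_cube a l 0 a)
      \<le> ennreal t * emeasure lebesgue (dyadic_cube a l 0 a)"
    and Q: "Q \<in> level_cubes a l f c t"
    and max: "\<And>R. R \<in> level_cubes a l f c t \<Longrightarrow> Q \<subseteq> R \<Longrightarrow> R = Q"
  shows "\<bar>average Q f - c\<bar> \<le> 2 ^ CARD('n) * t"
proof -
  obtain k x where Qkx: "Q = dyadic_cube a l k x"
    using Q by (auto simp: level_cubes_def dyadic_cubes_def)
  have x: "dyadic_cube a l 0 x = dyadic_cube a l 0 a"
  proof (rule dyadic_cube_eq)
    have "dyadic_cube a l k x \<subseteq> dyadic_cube a l 0 a"
      using Q unfolding Qkx level_cubes_def by simp
    then show "x \<in> dyadic_cube a l 0 a"
      using dyadic_cube_self by (rule subsetD)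
  qed
  have "k \<noteq> 0"
  proof
    assume "k = 0"
    with x Qkx have "Q = dyadic_cube a l 0 a"
      by simp
    with Q base show False
      by (simp add: level_cubes_def not_less[symmetric])
  qed
  then obtain j where k: "k = Suc j"
    using not0_implies_Suc by blast
  define P where "P = dyadic_cube a l j x"
  have meas: "emeasure lebesgue (dyadic_cube a l i y) = ennreal (measure lebesgue (dyadic_cube a l i y))" for i y
    using lmeasurable_dyadic_cube[OF l, of a i y] by (simp add: emeasure_eq_measure2)
  have Q0: "0 < measure lebesgue Q"
    using l by (simp add: Qkx measure_dyadic_cube)
  have PQ: "measure lebesgue P = 2 ^ CARD('n) * measure lebesgue Q"
    unfolding P_def Qkx k using measure_dyadic_cube_Suc[OF l] .
  have "measure lebesgue Q < measure lebesgue P"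
    unfolding PQ using Q0 by simp
  then have "P \<noteq> Q"
    by auto
  moreover have "Q \<subseteq> P"
    unfolding P_def Qkx k by (rule dyadic_cube_Suc_subset)
  ultimately have "P \<notin> level_cubes a l f c t"
    using max by blast
  then have "emeasure (deviation_measure f c) P \<le> ennreal t * emeasure lebesgue P"
    using dyadic_cube_mono[of 0 j a l x] x
    by (auto simp: level_cubes_def P_def dyadic_cube_in_dyadic_cubes not_less)
  then have "emeasure (deviation_measure f c) Q \<le> ennreal t * ennreal (measure lebesgue P)"
    using emeasure_mono[OF \<open>Q \<subseteq> P\<close>, of "deviation_measure f c"] lmeasurable_dyadic_cube[OF l, of a j x]
    unfolding P_def meas by (auto intro: order_trans)
  then have "(LINT x:Q|lebesgue. \<bar>f x - c\<bar>) \<le> t * measure lebesgue P"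
    using lmeasurable_dyadic_cube[OF l, of a k x] bounded_dyadic_cube[OF l, of a k x] t
    unfolding Qkx
    by (subst (asm) emeasure_deviation_measure_eq(1)[OF f]) (auto simp: ennreal_mult[symmetric])
  then have "\<bar>average Q f - c\<bar> * measure lebesgue Q \<le> t * measure lebesgue P"
    using average_minus_const_le[OF f _ _ Q0, of c]
      lmeasurable_dyadic_cube[OF l, of a k x] bounded_dyadic_cube[OF l, of a k x]
    unfolding Qkx by auto
  then have "\<bar>average Q f - c\<bar> * measure lebesgue Q \<le> (2 ^ CARD('n) * t) * measure lebesgue Q"
    unfolding PQ by (simp only: ac_simps)
  then show ?thesis
    using Q0 by (rule mult_right_le_imp_le)
qed

text \<open>A cube that meets \<open>Q\<close> and qualifies at the higher level lies inside \<open>Q\<close>, because \<open>Q\<close> is maximal.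
Replacing \<open>c\<close> by \<open>d\<close> costs at most \<open>M * t\<close> of the average, so \<open>\<bar>f - d\<bar>\<close> still has average at least \<open>t\<close>
over every such cube, and the maximal inequality on \<open>Q\<close> applies.\<close>

lemma level_cubes_local_estimate:
  fixes a :: "real ^ 'n"
  assumes l: "0 < l" and f: "locally_integrable f" and t: "0 \<le> t"
    and Q: "Q \<in> level_cubes a l f c t"
    and max: "\<And>R. R \<in> level_cubes a l f c t \<Longrightarrow> Q \<subseteq> R \<Longrightarrow> R = Q"
    and close: "\<bar>d - c\<bar> \<le> M * t" and M: "0 \<le> M"
  shows "ennreal t * emeasure lebesgue (\<Union>(level_cubes a l f c ((M + 1) * t)) \<inter> Q)
    \<le> emeasure (deviation_measure f d) Q"
proof -
  define \<A> where "\<A> = {R \<in> level_cubes a l f c ((M + 1) * t). R \<subseteq> Q}"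
  have fm: "f \<in> borel_measurable lebesgue"
    using f by (rule borel_measurable_locally_integrable)
  have Qd: "Q \<in> dyadic_cubes a l"
    using Q by (simp add: level_cubes_def)
  have sub: "level_cubes a l f c ((M + 1) * t) \<subseteq> level_cubes a l f c t"
    using t M by (intro level_cubes_antimono) (simp add: algebra_simps)
  have dy: "\<A> \<subseteq> dyadic_cubes a l"
    by (auto simp: \<A>_def level_cubes_def)
  have "R \<subseteq> Q" if "R \<in> level_cubes a l f c ((M + 1) * t)" "x \<in> R" "x \<in> Q" for R x
    using dyadic_cubes_nested[of R a l Q x] that Qd sub max[of R] by (auto simp: level_cubes_def)
  then have eq: "\<Union>(level_cubes a l f c ((M + 1) * t)) \<inter> Q = \<Union>\<A>"
    unfolding \<A>_def by blast
  have "ennreal t * emeasure lebesgue R \<le> 1 * emeasure (deviation_measure f d) R" if R: "R \<in> \<A>" for R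
  proof -
    have Rl: "R \<in> lmeasurable"
      using R dy dyadic_cubesD(2)[OF l] by blast
    have "ennreal ((M + 1) * t) * emeasure lebesgue R \<le> emeasure (deviation_measure f c) R"
      using R by (auto simp: \<A>_def level_cubes_def)
    also have "\<dots> \<le> emeasure (deviation_measure f d) R + ennreal \<bar>d - c\<bar> * emeasure lebesgue R"
      using Rl by (intro emeasure_deviation_measure_triangle fm) auto
    also have "\<dots> \<le> emeasure (deviation_measure f d) R + ennreal (M * t) * emeasure lebesgue R"
      using close by (intro add_left_mono mult_right_mono ennreal_leI) auto
    finally have "ennreal (M * t) * emeasure lebesgue R + ennreal t * emeasure lebesgue R
        \<le> ennreal (M * t) * emeasure lebesgue R + emeasure (deviation_measure f d) R"
      using t M by (simp add: distrib_right add.commute)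
    moreover have "ennreal (M * t) * emeasure lebesgue R \<noteq> top"
      using Rl M t by (simp add: emeasure_eq_measure2 ennreal_mult[symmetric])
    ultimately show ?thesis
      by (simp add: ennreal_add_left_cancel_le)
  qed
  then have "ennreal t * emeasure lebesgue (\<Union>\<A>) \<le> 1 * emeasure (deviation_measure f d) (\<Union>\<A>)"
    by (intro dyadic_covering_inequality[OF l dy]) auto
  also have "\<dots> \<le> emeasure (deviation_measure f d) Q"
    using dyadic_cubesD(2)[OF l Qd] by (auto intro!: emeasure_mono simp: \<A>_def)
  finally show ?thesis
    unfolding eq .
qed

text \<open>The local estimates with \<open>d\<close> the average of \<open>f\<close> over \<open>Q\<close> are summed over the maximal level cubes \<open>Q\<close>; the
JN condition is applied to exactly this disjoint family.\<close>

lemma good_lambda_inequality: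
  fixes a :: "real ^ 'n"
  assumes l: "0 < l" and f: "locally_integrable f" and JN: "JN_bound p f K" and p: "1 \<le> p"
    and t: "0 < t" and s: "0 < s"
    and base: "emeasure (deviation_measure f c) (dyadic_cube a l 0 a)
      \<le> ennreal t * emeasure lebesgue (dyadic_cube a l 0 a)"
  shows "t * measure lebesgue (\<Union>(level_cubes a l f c ((2 ^ CARD('n) + 1) * t)))
    \<le> s * measure lebesgue (\<Union>(level_cubes a l f c t)) + s powr (1 - p) * K powr p"
proof -
  let ?\<A> = "level_cubes a l f c" and ?m = "\<lambda>Q. measure lebesgue Q"
  let ?E = "\<Union>(?\<A> t)" and ?E' = "\<Union>(?\<A> ((2 ^ CARD('n) + 1) * t))"
  let ?o = "\<lambda>Q. mean_oscillation Q f"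
  obtain \<B> where \<B>: "\<B> \<subseteq> ?\<A> t" "disjoint \<B>" "\<Union>\<B> = ?E" "countable \<B>"
      "\<And>Q R. Q \<in> \<B> \<Longrightarrow> R \<in> ?\<A> t \<Longrightarrow> Q \<subseteq> R \<Longrightarrow> R = Q"
    using dyadic_maximal_subfamily[OF level_cubes_subset] by metis
  have E: "?E \<in> lmeasurable" "?E' \<in> lmeasurable"
    using lmeasurable_Union_level_cubes[OF l] by blast+
  have cube: "is_cube Q" "Q \<in> lmeasurable" "bounded Q" "0 < ?m Q" if "Q \<in> \<B>" for Q
    using dyadic_cubesD[OF l, of Q a] that \<B>(1) level_cubes_subset by blast+
  have Bs: "\<B> \<subseteq> sets lebesgue"
    using cube by blast
  have "t * 1 \<le> (2 ^ CARD('n) + 1) * t"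
    using t by simp
  then have "?E' \<subseteq> ?E"
    by (intro Union_mono level_cubes_antimono) simp
  then have E'E: "?E' = (\<Union>Q\<in>\<B>. ?E' \<inter> Q)"
    using \<B>(3) by blast
  have local: "ennreal t * emeasure lebesgue (?E' \<inter> Q)
      \<le> ennreal s * emeasure lebesgue Q + ennreal (s powr (1 - p)) * ennreal (?m Q * ?o Q powr p)"
    if Q: "Q \<in> \<B>" for Q
  proof -
    have "ennreal t * emeasure lebesgue (?E' \<inter> Q) \<le> emeasure (deviation_measure f (average Q f)) Q"
    proof (rule level_cubes_local_estimate[OF l f])
      show "\<bar>average Q f - c\<bar> \<le> 2 ^ CARD('n) * t"
        using level_cubes_maximal_average[OF l f _ base] Q \<B>(1,5) t by (meson less_imp_le subsetD)
    qed (use Q \<B> t in auto)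
    also have "\<dots> = ennreal (?m Q * ?o Q)"
      using cube[OF Q] f by (simp add: emeasure_deviation_measure_average)
    also have "\<dots> \<le> ennreal (?m Q * (s + s powr (1 - p) * ?o Q powr p))"
      using le_split_powr[OF mean_oscillation_nonneg s p]
      by (intro ennreal_leI mult_left_mono) auto
    also have "\<dots> = ennreal s * ennreal (?m Q) + ennreal (s powr (1 - p)) * ennreal (?m Q * ?o Q powr p)"
      using s by (simp add: algebra_simps flip: ennreal_plus ennreal_mult)
    finally show ?thesis
      using cube[OF Q] by (simp add: emeasure_eq_measure2)
  qed
  have "ennreal t * emeasure lebesgue ?E' = ennreal t * (\<integral>\<^sup>+Q. emeasure lebesgue (?E' \<inter> Q) \<partial>count_space \<B>)"
  proof (subst E'E, subst emeasure_UN_countable)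
    show "disjoint_family_on (\<lambda>Q. ?E' \<inter> Q) \<B>"
      using \<B>(2) by (auto simp: disjoint_family_on_def disjoint_def)
  qed (use \<B>(4) Bs E in auto)
  also have "\<dots> = (\<integral>\<^sup>+Q. ennreal t * emeasure lebesgue (?E' \<inter> Q) \<partial>count_space \<B>)"
    by (simp add: nn_integral_cmult)
  also have "\<dots> \<le> (\<integral>\<^sup>+Q. ennreal s * emeasure lebesgue Q +
      ennreal (s powr (1 - p)) * ennreal (?m Q * ?o Q powr p) \<partial>count_space \<B>)"
    using local by (intro nn_integral_mono) simp
  also have "\<dots> = ennreal s * emeasure lebesgue ?E +
      ennreal (s powr (1 - p)) * (\<integral>\<^sup>+Q. ennreal (?m Q * ?o Q powr p) \<partial>count_space \<B>)"
    unfolding \<B>(3)[symmetric] emeasure_Union_disjoint[OF \<B>(4,2) Bs]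
    by (simp add: nn_integral_add nn_integral_cmult)
  also have "\<dots> \<le> ennreal s * emeasure lebesgue ?E + ennreal (s powr (1 - p)) * ennreal (K powr p)"
    using JN_bound_count_space[OF JN \<B>(4,2) cube(1)] by (intro add_left_mono mult_left_mono) auto
  finally have "ennreal (t * ?m ?E') \<le> ennreal (s * ?m ?E + s powr (1 - p) * K powr p)"
    using E s t by (simp add: emeasure_eq_measure2 ennreal_mult)
  then show ?thesis
    using s by (subst (asm) ennreal_le_iff) auto
qed

text \<open>With \<open>s = \<epsilon> * t\<close> and \<open>\<epsilon> = 1 / (2 * L powr p)\<close>, and with \<open>B\<close> the claimed bound, the hypothesis \<open>step\<close> says
that \<open>A (L * t) \<le> A t / 2 + B / 2\<close> for \<open>A t = t powr p * e t\<close>; hence \<open>A \<le> B\<close> propagates from \<open>t\<close> to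
\<open>L * t\<close>. For \<open>t\<close> between \<open>\<tau>\<close> and \<open>L * \<tau>\<close> the trivial bound by \<open>V\<close> is good enough.\<close>

lemma iterate_good_lambda:
  fixes e :: "real \<Rightarrow> real"
  assumes p: "1 \<le> p" and \<tau>: "0 < \<tau>" and L: "1 < L" and K: "0 < K"
    and e: "\<And>t. 0 \<le> e t" "\<And>t. e t \<le> V" and V: "\<tau> powr p * V \<le> K powr p"
    and step: "\<And>t s. \<tau> \<le> t \<Longrightarrow> 0 < s \<Longrightarrow> t * e (L * t) \<le> s * e t + s powr (1 - p) * K powr p"
    and t: "\<tau> \<le> t"
  shows "t powr p * e t \<le> (2 * L powr p) powr p * K powr p"
proof -
  define B where "B = (2 * L powr p) powr p * K powr p"
  have L0: "0 < L powr p"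
    using L by simp
  have Lp: "1 \<le> L powr p"
    using L p by (simp add: ge_one_powr_ge_zero)
  have "\<forall>t. \<tau> \<le> t \<and> t \<le> L ^ n * \<tau> \<longrightarrow> t powr p * e t \<le> B" for n
  proof (induction n)
    case 0
    have "1 \<le> (2 * L powr p) powr p"
      using Lp p by (intro ge_one_powr_ge_zero) auto
    then have "K powr p \<le> B"
      unfolding B_def by (simp add: mult_le_cancel_right1)
    moreover have "\<tau> powr p * e \<tau> \<le> \<tau> powr p * V"
      using e by (intro mult_left_mono) auto
    ultimately show ?case
      using V by auto
  next
    case (Suc n)
    show ?case
    proof (intro allI impI)
      fix t assume t: "\<tau> \<le> t \<and> t \<le> L ^ Suc n * \<tau>"
      show "t powr p * e t \<le> B"
      proof (cases "t \<le> L * \<tau>")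
        case True
        have "t powr p * e t \<le> (L * \<tau>) powr p * V"
          using True t \<tau> e p by (intro mult_mono powr_mono2) auto
        also have "\<dots> = L powr p * (\<tau> powr p * V)"
          using L \<tau> by (simp add: powr_mult)
        also have "\<dots> \<le> L powr p * K powr p"
          using V by (intro mult_left_mono) auto
        also have "\<dots> \<le> (2 * L powr p) powr 1 * K powr p"
          using L0 by (intro mult_right_mono) simp_all
        also have "\<dots> \<le> B"
          unfolding B_def using Lp p by (intro mult_right_mono powr_mono) auto
        finally show ?thesis .
      next
        case False
        define u where "u = t / L"
        define \<epsilon> where "\<epsilon> = 1 / (2 * L powr p)"
        have u: "\<tau> \<le> u" "u \<le> L ^ n * \<tau>" "L * u = t" "0 < u"
          using False t L \<tau> by (auto simp: u_def field_simps)
        have \<epsilon>: "0 < \<epsilon>"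
          using L0 by (simp add: \<epsilon>_def)
        have IH: "u powr p * e u \<le> B"
          using Suc u by blast
        have "u * e t \<le> \<epsilon> * u * e u + (\<epsilon> * u) powr (1 - p) * K powr p"
          using step[of u "\<epsilon> * u"] u \<epsilon> by simp
        then have "u powr (p - 1) * (u * e t) \<le>
            u powr (p - 1) * (\<epsilon> * u * e u + (\<epsilon> * u) powr (1 - p) * K powr p)"
          by (intro mult_left_mono) auto
        moreover have "u powr (p - 1) * u = u powr p"
          using u by (simp add: powr_diff)
        moreover have "u powr (p - 1) * (\<epsilon> * u) powr (1 - p) = \<epsilon> powr (1 - p)"
          using u \<epsilon> by (simp add: powr_mult powr_diff)
        moreover have "w * (x * y) = (w * x) * y" "w * (\<epsilon> * x * y + z * k) = \<epsilon> * ((w * x) * y) + (w * z) * k"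
          for w x y z k :: real
          by (simp_all add: algebra_simps)
        ultimately have "u powr p * e t \<le> \<epsilon> * (u powr p * e u) + \<epsilon> powr (1 - p) * K powr p"
          by (simp only:)
        also have "\<dots> \<le> \<epsilon> * B + \<epsilon> powr (1 - p) * K powr p"
          using IH \<epsilon> by simp
        also have "\<epsilon> powr (1 - p) * K powr p = \<epsilon> * B"
          using L0 by (simp add: \<epsilon>_def B_def powr_diff powr_divide field_simps)
        finally have "L powr p * (u powr p * e t) \<le> L powr p * (\<epsilon> * B + \<epsilon> * B)"
          by (intro mult_left_mono) auto
        also have "\<dots> = B"
          using L0 by (simp add: \<epsilon>_def)
        finally have "(L powr p * u powr p) * e t \<le> B"
          by (simp only: mult.assoc)
        moreover have "t powr p = L powr p * u powr p"
          using powr_mult[of L u p] u(3) by simp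
        ultimately show ?thesis
          by simp
      qed
    qed
  qed
  moreover obtain n where "t / \<tau> < L ^ n"
    using real_arch_pow[OF L] by blast
  then have "t \<le> L ^ n * \<tau>"
    using \<tau> by (simp add: pos_divide_less_eq less_imp_le)
  ultimately show ?thesis
    using t unfolding B_def by blast
qed

section \<open>The John-Nirenberg inequality on a cube\<close>

text \<open>The smallest admissible \<open>t\<close> is chosen to serve two purposes: by \<open>mean_oscillation_le\<close> it is at least
the mean oscillation over the base cube, as the good-lambda inequality requires, and its \<open>p\<close>-th power times
the measure of the base cube is exactly \<open>K powr p\<close>, which starts the iteration.\<close>

lemma measure_level_cubes_le:
  fixes a :: "real ^ 'n"
  assumes l: "0 < l" and f: "locally_integrable f" and JN: "JN_bound p f K" and p: "1 \<le> p"
    and K: "0 < K" and t: "K * measure lebesgue (dyadic_cube a l 0 a) powr (- 1 / p) \<le> t"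
  shows "t powr p * measure lebesgue (\<Union>(level_cubes a l f (average (dyadic_cube a l 0 a) f) t))
    \<le> (2 * (2 ^ CARD('n) + 1) powr p) powr p * K powr p"
proof -
  let ?Q = "dyadic_cube a l 0 a"
  let ?v = "measure lebesgue ?Q" and ?c = "average ?Q f"
  note Q = dyadic_cubesD[OF l dyadic_cube_in_dyadic_cubes[of a l 0 a]]
  define \<tau> where "\<tau> = K * ?v powr (- 1 / p)"
  have \<tau>: "0 < \<tau>"
    using K Q(4) by (simp add: \<tau>_def)
  have \<tau>v: "\<tau> powr p * ?v = K powr p"
    unfolding \<tau>_def powr_mult powr_powr using p Q(4) by (simp add: powr_minus)
  have osc: "mean_oscillation ?Q f \<le> \<tau>"
    unfolding \<tau>_def using mean_oscillation_le[OF JN _ Q(1,4)] p by simp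
  show ?thesis
  proof (rule iterate_good_lambda[OF p \<tau> _ K])
    show "measure lebesgue (\<Union>(level_cubes a l f ?c s)) \<le> ?v" for s
      using Q(2) lmeasurable_Union_level_cubes[OF l, of a f ?c s]
      by (intro measure_mono_fmeasurable) (auto simp: level_cubes_def)
    show "r * measure lebesgue (\<Union>(level_cubes a l f ?c ((2 ^ CARD('n) + 1) * r)))
        \<le> s * measure lebesgue (\<Union>(level_cubes a l f ?c r)) + s powr (1 - p) * K powr p"
      if r: "\<tau> \<le> r" and s: "0 < s" for r s
    proof (rule good_lambda_inequality[OF l f JN p _ s])
      show "0 < r"
        using \<tau> r by simp
      have "emeasure (deviation_measure f ?c) ?Q = ennreal (?v * mean_oscillation ?Q f)"
        using emeasure_deviation_measure_average[OF f Q(3,2,4)] .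
      also have "\<dots> \<le> ennreal (?v * r)"
        using osc r Q(4) by (intro ennreal_leI mult_left_mono) auto
      also have "\<dots> = ennreal r * emeasure lebesgue ?Q"
        unfolding emeasure_eq_measure2[OF Q(2)] using \<open>0 < r\<close> by (simp add: ennreal_mult mult.commute)
      finally show "emeasure (deviation_measure f ?c) ?Q \<le> ennreal r * emeasure lebesgue ?Q" .
    qed
  qed (use \<tau>v t in \<open>auto simp: \<tau>_def\<close>)
qed

lemma measure_exceed_le_level_cubes:
  fixes a :: "real ^ 'n"
  assumes l: "0 < l" and f: "locally_integrable f" and t: "0 \<le> t"
  shows "{x \<in> dyadic_cube a l 0 a. t < \<bar>f x - c\<bar>} \<in> lmeasurable" (is "?S \<in> _")
    and "measure lebesgue {x \<in> dyadic_cube a l 0 a. t < \<bar>f x - c\<bar>}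
      \<le> measure lebesgue (\<Union>(level_cubes a l f c t))" (is "_ \<le> measure lebesgue ?E")
proof -
  let ?Q = "dyadic_cube a l 0 a"
  note Q = dyadic_cubesD[OF l dyadic_cube_in_dyadic_cubes[of a l 0 a]]
  have [measurable]: "f \<in> borel_measurable lebesgue"
    using f by (rule borel_measurable_locally_integrable)
  have [measurable]: "?Q \<in> sets lebesgue"
    using Q(2) by auto
  have "?S \<in> sets lebesgue"
    by measurable
  then show S: "?S \<in> lmeasurable"
    by (rule fmeasurableI2[OF Q(2), rotated]) auto
  have E: "?E \<in> lmeasurable"
    using lmeasurable_Union_level_cubes[OF l] .
  have "?S - ?E \<in> null_sets lebesgue"
  proof (rule null_set_low_dyadic_averages[OF l])
    show "(\<lambda>x. ennreal \<bar>f x - c\<bar>) \<in> borel_measurable lebesgue"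
      by measurable
    show "?S - ?E \<in> lmeasurable"
      using S E by (rule fmeasurable.Diff)
    show "ennreal t < ennreal \<bar>f x - c\<bar>" if "x \<in> ?S - ?E" for x
      using that t by (simp add: ennreal_less_iff)
    show "emeasure (density lebesgue (\<lambda>x. ennreal \<bar>f x - c\<bar>)) (dyadic_cube a l k x)
        \<le> ennreal t * emeasure lebesgue (dyadic_cube a l k x)" if x: "x \<in> ?S - ?E" for x k
    proof -
      have "dyadic_cube a l k x \<subseteq> ?Q"
        using dyadic_cube_mono[of 0 k a l x] dyadic_cube_eq[of x a l 0 a] x by simp
      moreover have "dyadic_cube a l k x \<notin> level_cubes a l f c t"
        using x dyadic_cube_self by blast
      ultimately show ?thesis
        by (simp only: level_cubes_def deviation_measure_def mem_Collect_eq
            dyadic_cube_in_dyadic_cubes not_less simp_thms)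
    qed
  qed
  then have null: "measure lebesgue (?S - ?E) = 0"
    by (rule measure_eq_0_null_sets)
  have "measure lebesgue ?S \<le> measure lebesgue ((?S - ?E) \<union> ?E)"
    using S E by (intro measure_mono_fmeasurable fmeasurable.Un fmeasurable.Diff) auto
  also have "\<dots> \<le> measure lebesgue (?S - ?E) + measure lebesgue ?E"
    using S E by (intro measure_Un_le fmeasurableD fmeasurable.Diff)
  finally show "measure lebesgue ?S \<le> measure lebesgue ?E"
    using null by simp
qed

section \<open>Passage to the whole space\<close>

text \<open>The cubes \<open>[-2 ^ m, 2 ^ m) ^ n\<close>. They are written as base cubes of dyadic subdivisions, so that the estimates
on a base cube apply as they stand.\<close>

definition centred_cube :: "nat \<Rightarrow> (real ^ 'n) set" where
  "centred_cube m = dyadic_cube (\<chi> i. - (2 ^ m)) (2 ^ Suc m) 0 (\<chi> i. - (2 ^ m))"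

lemma centred_cube_eq: "centred_cube m = {x. \<forall>i. - (2 ^ m) \<le> x $ i \<and> x $ i < 2 ^ m}"
  unfolding centred_cube_def by (subst dyadic_cube_base) auto

lemma centred_cubeD:
  shows "is_cube (centred_cube m :: (real ^ 'n) set)"
    and "(centred_cube m :: (real ^ 'n) set) \<in> lmeasurable"
    and "bounded (centred_cube m :: (real ^ 'n) set)"
    and "0 < measure lebesgue (centred_cube m :: (real ^ 'n) set)"
  unfolding centred_cube_def
  by (rule dyadic_cubesD[OF _ dyadic_cube_in_dyadic_cubes], simp)+

lemma measure_centred_cube:
  "measure lebesgue (centred_cube m :: (real ^ 'n) set) = (2 ^ Suc m) ^ CARD('n)"
  unfolding centred_cube_def by (subst measure_dyadic_cube) auto

lemma mono_centred_cube: "m \<le> k \<Longrightarrow> centred_cube m \<subseteq> centred_cube k"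
proof -
  assume "m \<le> k"
  then have "(2 :: real) ^ m \<le> 2 ^ k"
    by (rule power_increasing) simp
  then have "- (2 ^ m) \<le> u \<and> u < 2 ^ m \<Longrightarrow> - (2 ^ k) \<le> u \<and> u < 2 ^ k" for u :: real
    by linarith
  then show ?thesis
    unfolding centred_cube_eq by blast
qed

lemma centred_cube_cover:
  fixes x :: "real ^ 'n"
  obtains m where "x \<in> centred_cube m"
proof -
  obtain m where m: "norm x < 2 ^ m"
    using real_arch_pow[of 2 "norm x"] by (meson one_less_numeral_iff semiring_norm(76))
  have "- (2 ^ m) \<le> x $ i \<and> x $ i < 2 ^ m" for i
    using component_le_norm_cart[of x i] m by linarith
  then show ?thesis
    using that by (auto simp: centred_cube_eq)
qed

lemma measure_centred_cube_powr:
  "measure lebesgue (centred_cube m :: (real ^ 'n) set) powr (- 1 / p)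
    = (2 powr (- real CARD('n) / p)) ^ Suc m"
proof -
  have "measure lebesgue (centred_cube m :: (real ^ 'n) set) = 2 powr real (Suc m * CARD('n))"
    unfolding measure_centred_cube by (simp only: power_mult[symmetric] powr_realpow zero_less_numeral)
  moreover have "(2 powr (- real CARD('n) / p)) ^ Suc m = (2 powr (- real CARD('n) / p)) powr real (Suc m)"
    by (subst powr_realpow) simp_all
  moreover have "real (Suc m * CARD('n)) * (- 1 / p) = - real CARD('n) / p * real (Suc m)"
    by (simp only: of_nat_mult) simp
  ultimately show ?thesis
    by (simp only: powr_powr)
qed

text \<open>Consecutive averages differ by at most \<open>2 ^ n\<close> times the mean oscillation over the larger cube, and these
oscillations form a geometrically decaying sequence.\<close>

lemma convergent_centred_averages:
  fixes f :: "real ^ 'n \<Rightarrow> real"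
  assumes f: "locally_integrable f" and JN: "JN_bound p f K" and p: "0 < p"
  shows "convergent (\<lambda>m. average (centred_cube m) f)"
proof -
  let ?A = "\<lambda>m. average (centred_cube m) f"
  define q where "q = 2 powr (- real CARD('n) / p)"
  have q: "0 < q" "q < 1"
    using p by (auto simp: q_def powr_less_one)
  have diff: "norm (?A (Suc m) - ?A m) \<le> 2 ^ CARD('n) * K * q ^ Suc (Suc m)" for m
  proof -
    have "\<bar>?A m - ?A (Suc m)\<bar> \<le>
        measure lebesgue (centred_cube (Suc m) :: (real ^ 'n) set) /
        measure lebesgue (centred_cube m :: (real ^ 'n) set) * mean_oscillation (centred_cube (Suc m)) f"
      by (intro average_diff_le[OF f] mono_centred_cube centred_cubeD) simp
    also have "measure lebesgue (centred_cube (Suc m) :: (real ^ 'n) set) =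
        2 ^ CARD('n) * measure lebesgue (centred_cube m :: (real ^ 'n) set)"
      unfolding measure_centred_cube by (simp only: power_Suc[of 2 "Suc m"] power_mult_distrib)
    also have "\<dots> / measure lebesgue (centred_cube m :: (real ^ 'n) set) = 2 ^ CARD('n)"
      using centred_cubeD(4)[of m, where 'n = 'n] by simp
    also have "2 ^ CARD('n) * mean_oscillation (centred_cube (Suc m)) f \<le> 2 ^ CARD('n) * (K * q ^ Suc (Suc m))"
      using mean_oscillation_le[OF JN p centred_cubeD(1,4)[of "Suc m"]]
      unfolding q_def measure_centred_cube_powr by (rule mult_left_mono) simp
    finally show ?thesis
      by (simp only: real_norm_def abs_minus_commute mult.assoc)
  qed
  have "summable (\<lambda>m. ?A (Suc m) - ?A m)"
  proof (rule summable_comparison_test'[of "\<lambda>m. 2 ^ CARD('n) * K * q ^ Suc (Suc m)" 0])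
    show "summable (\<lambda>m. 2 ^ CARD('n) * K * q ^ Suc (Suc m))"
      using q by (intro summable_mult iffD2[OF summable_Suc_iff] summable_geometric) simp
  qed (rule diff)
  then have "convergent (\<lambda>m. \<Sum>i<m. ?A (Suc i) - ?A i)"
    by (simp add: summable_iff_convergent)
  then have "convergent (\<lambda>m. ?A m - ?A 0)"
    by (simp only: sum_lessThan_telescope[of ?A])
  then have "convergent (\<lambda>m. ?A 0 + (?A m - ?A 0))"
    by (intro convergent_add convergent_const)
  then show ?thesis
    by simp
qed

lemma weak_Lp_norm_leI:
  assumes p: "0 < p" and B: "0 \<le> B"
    and le: "\<And>t. 0 < t \<Longrightarrow> emeasure lebesgue {x. t < \<bar>h x\<bar>} \<le> ennreal ((B / t) powr p)"
  shows "weak_Lp_norm p h \<le> ennreal B"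
  unfolding weak_Lp_norm_def
proof (rule SUP_least)
  fix t :: real assume "t \<in> {0<..}"
  then have t: "0 < t" by simp
  let ?m = "emeasure lebesgue {x. t < \<bar>h x\<bar>}"
  have fin: "?m \<noteq> \<infinity>"
    using le[OF t] by (auto simp: top_unique)
  have "enn2real ?m \<le> (B / t) powr p"
    using enn2real_mono[OF le[OF t]] by simp
  then have "enn2real ?m powr (1 / p) \<le> ((B / t) powr p) powr (1 / p)"
    using p by (intro powr_mono2) auto
  also have "\<dots> = B / t"
    using p B t by (simp add: powr_powr)
  finally have "ennreal t * ennreal (enn2real ?m powr (1 / p)) \<le> ennreal t * ennreal (B / t)"
    by (intro mult_left_mono ennreal_leI) auto
  also have "\<dots> = ennreal B"
    using t B by (simp flip: ennreal_mult)
  finally show "ennreal t * ennreal_powr ?m (1 / p) \<le> ennreal B"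
    using fin by (simp add: ennreal_powr_def)
qed

text \<open>The factor 4 is \<open>2 * 2\<close>: one 2 from \<open>iterate_good_lambda\<close>, and one because half of \<open>t\<close> is given
away to absorb the difference between \<open>b\<close> and the average over a large cube.\<close>

lemma weak_Lp_norm_JN_bound_le:
  fixes f :: "real ^ 'n \<Rightarrow> real"
  assumes f: "locally_integrable f" and JN: "JN_bound p f K" and p: "1 \<le> p" and K: "0 < K"
    and b: "(\<lambda>m. average (centred_cube m :: (real ^ 'n) set) f) \<longlonglongrightarrow> b"
  shows "weak_Lp_norm p (\<lambda>x. f x - b) \<le> ennreal (4 * (2 ^ CARD('n) + 1) powr p * K)"
proof (rule weak_Lp_norm_leI)
  fix t :: real assume t: "0 < t"
  let ?Q = "\<lambda>m. centred_cube m :: (real ^ 'n) set"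
  define L where "L = (2 ^ CARD('n) + 1 :: real)"
  define B where "B = 4 * L powr p * K"
  define q where "q = 2 powr (- real CARD('n) / p)"
  have q: "0 < q" "q < 1"
    using p by (auto simp: q_def powr_less_one)
  have [measurable]: "f \<in> borel_measurable lebesgue"
    using f by (rule borel_measurable_locally_integrable)
  have [measurable]: "?Q m \<in> sets lebesgue" for m
    using centred_cubeD(2)[of m, where 'n = 'n] by auto
  have "(\<lambda>m. K * q ^ Suc m) \<longlonglongrightarrow> K * 0"
    using q by (intro tendsto_mult tendsto_const LIMSEQ_Suc LIMSEQ_realpow_zero) auto
  then have "\<forall>\<^sub>F m in sequentially. K * q ^ Suc m < t / 2"
    by (rule order_tendstoD) (use t in simp)
  moreover have "\<forall>\<^sub>F m in sequentially. dist (average (?Q m) f) b < t / 2"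
    using b by (rule tendstoD) (use t in simp)
  ultimately have "\<forall>\<^sub>F m in sequentially.
      emeasure lebesgue {x \<in> ?Q m. t < \<bar>f x - b\<bar>} \<le> ennreal ((B / t) powr p)"
  proof eventually_elim
    case (elim m)
    let ?A = "average (?Q m) f"
    let ?S = "{x \<in> ?Q m. t / 2 < \<bar>f x - ?A\<bar>}"
    have "K * measure lebesgue (?Q m) powr (- 1 / p) \<le> t / 2"
      using elim(1) unfolding q_def measure_centred_cube_powr by linarith
    then have E: "(t / 2) powr p * measure lebesgue (\<Union>(level_cubes (\<chi> i. - (2 ^ m)) (2 ^ Suc m) f ?A (t / 2)))
        \<le> (2 * L powr p) powr p * K powr p"
      unfolding centred_cube_def L_def by (intro measure_level_cubes_le[OF _ f JN p K]) simp_all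
    have S: "?S \<in> lmeasurable" "measure lebesgue ?S \<le>
        measure lebesgue (\<Union>(level_cubes (\<chi> i. - (2 ^ m)) (2 ^ Suc m) f ?A (t / 2)))"
      unfolding centred_cube_def by (intro measure_exceed_le_level_cubes[OF _ f]; use t in simp)+
    have "(t / 2) powr p * measure lebesgue ?S \<le> (2 * L powr p) powr p * K powr p"
      using S(2) E by (meson mult_left_mono order_trans powr_ge_zero)
    then have "measure lebesgue ?S \<le> (2 * L powr p * K) powr p / (t / 2) powr p"
      using t by (simp add: powr_mult pos_le_divide_eq mult.commute)
    also have "\<dots> = (B / t) powr p"
      using t by (simp add: B_def mult.assoc flip: powr_divide)
    finally have "emeasure lebesgue ?S \<le> ennreal ((B / t) powr p)"
      using S(1) by (simp only: emeasure_eq_measure2 ennreal_leI)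
    moreover have "emeasure lebesgue {x \<in> ?Q m. t < \<bar>f x - b\<bar>} \<le> emeasure lebesgue ?S"
    proof (rule emeasure_mono)
      have "t / 2 < \<bar>u - ?A\<bar>" if "t < \<bar>u - b\<bar>" for u
        using that elim(2) unfolding dist_real_def by linarith
      then show "{x \<in> ?Q m. t < \<bar>f x - b\<bar>} \<subseteq> ?S"
        by blast
    qed (use S in auto)
    ultimately show ?case
      by (rule order_trans[rotated])
  qed
  then obtain N where N: "\<And>m. N \<le> m \<Longrightarrow>
      emeasure lebesgue {x \<in> ?Q m. t < \<bar>f x - b\<bar>} \<le> ennreal ((B / t) powr p)"
    unfolding eventually_sequentially by blast
  let ?T = "\<lambda>m. {x \<in> ?Q m. t < \<bar>f x - b\<bar>}"
  have inc: "incseq ?T"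
    using mono_centred_cube unfolding incseq_def by blast
  have "{x. t < \<bar>f x - b\<bar>} = (\<Union>m. ?T m)"
    using centred_cube_cover by blast
  then have "emeasure lebesgue {x. t < \<bar>f x - b\<bar>} = (SUP m. emeasure lebesgue (?T m))"
    using inc by (subst SUP_emeasure_incseq) auto
  also have "\<dots> \<le> ennreal ((B / t) powr p)"
  proof (rule SUP_least)
    fix m
    have "emeasure lebesgue (?T m) \<le> emeasure lebesgue (?T (max m N))"
      using incseqD[OF inc, of m "max m N"] by (intro emeasure_mono) auto
    also have "\<dots> \<le> ennreal ((B / t) powr p)"
      by (rule N) simp
    finally show "emeasure lebesgue (?T m) \<le> ennreal ((B / t) powr p)" .
  qed
  finally show "emeasure lebesgue {x. t < \<bar>f x - b\<bar>}
      \<le> ennreal ((4 * (2 ^ CARD('n) + 1) powr p * K / t) powr p)"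
    unfolding B_def L_def .
qed (use p K in auto)

theorem theorem5p2:
  fixes p :: real
  assumes "1 < p"
  shows "\<exists>c::real. 0 < c \<and>
    (\<forall>f \<in> (JN p :: (real ^ 'n \<Rightarrow> real) set).
       f \<in> weak_Lp_mod_const p \<and>
       (\<exists>b::real. weak_Lp_norm p (\<lambda>x. f x - b) \<le> ennreal (c * JN_norm p f)))"
proof (rule exI, intro conjI ballI)
  let ?c = "4 * (2 ^ CARD('n) + 1) powr p :: real"
  have "0 < (2 ^ CARD('n) + 1 :: real)"
    by (simp add: add_pos_pos)
  then show c: "0 < ?c"
    by simp
  fix f :: "real ^ 'n \<Rightarrow> real" assume "f \<in> JN p"
  then obtain K0 where f: "locally_integrable f" and K0: "JN_bound p f K0"
    by (auto simp: JN_def)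
  define b where "b = lim (\<lambda>m. average (centred_cube m :: (real ^ 'n) set) f)"
  have b: "(\<lambda>m. average (centred_cube m :: (real ^ 'n) set) f) \<longlonglongrightarrow> b"
    unfolding b_def using convergent_centred_averages[OF f K0] assms
    by (simp add: convergent_LIMSEQ_iff)
  have bound: "weak_Lp_norm p (\<lambda>x. f x - b) \<le> ennreal (?c * JN_norm p f)"
  proof (rule ennreal_le_epsilon)
    fix e :: real assume e: "0 < e"
    \<comment> \<open>The bound for a given \<open>K\<close> requires \<open>0 < K\<close>, whereas the infimum may be 0: one \<open>d\<close> is spent on
  approximating the infimum, the other one on making the bound positive.\<close>
    define d where "d = e / (2 * ?c)"
    have d: "0 < d" "?c * (JN_norm p f + 2 * d) = ?c * JN_norm p f + e"
      using e c by (auto simp: d_def algebra_simps)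
    have nonneg: "0 \<le> JN_norm p f"
      unfolding JN_norm_def
    proof (rule cInf_greatest)
      show "{K. JN_bound p f K} \<noteq> {}"
        using K0 by blast
    qed (simp add: JN_bound_def)
    have "Inf {K. JN_bound p f K} < JN_norm p f + d"
      using d by (simp add: JN_norm_def)
    then obtain K where K: "JN_bound p f K" "K < JN_norm p f + d"
      using cInf_lessD[of "{K. JN_bound p f K}"] K0 by blast
    have "JN_bound p f (K + d)"
      using K(1) by (rule JN_bound_mono) (use d assms in auto)
    then have "weak_Lp_norm p (\<lambda>x. f x - b) \<le> ennreal (?c * (K + d))"
      using K(1) d assms by (intro weak_Lp_norm_JN_bound_le[OF f _ _ _ b]) (auto simp: JN_bound_def)
    also have "\<dots> \<le> ennreal (?c * (JN_norm p f + 2 * d))"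
      using K(2) c by (intro ennreal_leI mult_left_mono) auto
    also have "\<dots> = ennreal (?c * JN_norm p f) + ennreal e"
      unfolding d(2) using nonneg c e by (intro ennreal_plus) auto
    finally show "weak_Lp_norm p (\<lambda>x. f x - b) \<le> ennreal (?c * JN_norm p f) + ennreal e" .
  qed
  then show "\<exists>b. weak_Lp_norm p (\<lambda>x. f x - b) \<le> ennreal (?c * JN_norm p f)"
    by blast
  have "(\<lambda>x. f x - b) \<in> weak_Lp p"
    using bound borel_measurable_locally_integrable[OF f]
    by (auto simp: weak_Lp_def intro: order.strict_trans1)
  then show "f \<in> weak_Lp_mod_const p"
    using f by (auto simp: weak_Lp_mod_const_def)
qed

end
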